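(* Let $(X,x_0)$ be an arbitrary pointed topological space. If $(\widetilde X,p)$ is a generalized covering space of $X$, then the fibre $p^{-1}(x_0)\subseteq \widetilde X$ is totally path disconnected.
   Context: A continuous map $p:(\widetilde X,\tilde x_0)\to (X,x_0)$ has the unique lifting property if for every connected, locally path connected space $(Y,y_0)$ and every continuous map $f:(Y,y_0)\to (X,x_0)$ with $f_*\pi_1(Y,y_0)\subseteq p_*\pi_1(\widetilde X,\tilde x_0)$ there exists a unique continuous map $\tilde f:(Y,y_0)\to(\widetilde X,\tilde x_0)$ with $p\circ \tilde f=f$. If moreover $\widetilde X$ is connected and locally path connected, then $p$ is called a generalized covering map and $(\widetilde X,p)$ a generalized covering space of $X$. A space is totally path disconnected if every path in it is constant. *)

theory Defs
  imports "HOL-Analysis.Analysis"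
begin

text \<open>
  Spaces are abstract topologies, so a map between spaces only matters on the carrier (and a path
  or loop only on the unit interval); its values elsewhere are junk.
\<close>

definition loops_at :: "'a topology \<Rightarrow> 'a \<Rightarrow> (real \<Rightarrow> 'a) set" where
  "loops_at X x0 = {g. pathin X g \<and> g 0 = x0 \<and> g 1 = x0}"

definition loop_homotopy :: "'a topology \<Rightarrow> 'a \<Rightarrow> ((real \<Rightarrow> 'a) \<times> (real \<Rightarrow> 'a)) set" where
  "loop_homotopy X x0 = {(g, h). g \<in> loops_at X x0 \<and> h \<in> loops_at X x0 \<and>
     homotopic_with (\<lambda>l. l 0 = x0 \<and> l 1 = x0) (top_of_set {0..1}) X g h}"

text \<open>
  The underlying set of the fundamental group. The group operation is not introduced, because
  containment of two subgroups of the same group is containment of their underlying sets.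
\<close>

definition fundamental_group :: "'a topology \<Rightarrow> 'a \<Rightarrow> (real \<Rightarrow> 'a) set set" where
  "fundamental_group X x0 = loops_at X x0 // loop_homotopy X x0"

text \<open>
  The homomorphism induced by a pointed map into \<open>(X, x0)\<close>: it sends the class of a loop \<open>g\<close>
  to the class of \<open>f \<circ> g\<close>.
\<close>

definition induced_map ::
  "'a topology \<Rightarrow> 'a \<Rightarrow> ('b \<Rightarrow> 'a) \<Rightarrow> (real \<Rightarrow> 'b) set \<Rightarrow> (real \<Rightarrow> 'a) set" where
  "induced_map X x0 f c = loop_homotopy X x0 `` ((\<lambda>g. f \<circ> g) ` c)"

definition pointed_map ::
  "'a topology \<Rightarrow> 'a \<Rightarrow> 'b topology \<Rightarrow> 'b \<Rightarrow> ('a \<Rightarrow> 'b) \<Rightarrow> bool" where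
  "pointed_map X x0 Y y0 f \<longleftrightarrow> x0 \<in> topspace X \<and> continuous_map X Y f \<and> f x0 = y0"

text \<open>
  Test spaces \<open>Y\<close> cannot range over all types inside a formula; here they are all topologies
  carried by a subset of \<^typ>\<open>'a set \<times> real\<close>, where \<^typ>\<open>'a\<close> is the type of the base \<open>X\<close>.
  For a map \<open>p\<close> from a connected, locally path connected space this gives the same notion as
  arbitrary test spaces:

  \<^item> A lift on an arbitrary \<open>Y\<close> is determined pointwise by lifting paths, so its uniqueness, and
    its existence as a function, only involve the interval and the square as test spaces.
  \<^item> Suppose this function \<open>l\<close> on \<open>Y\<close> were discontinuous at \<open>y\<close>, witnessed by an open \<open>U\<close> around
    \<open>l y\<close>. For each open \<open>W\<close> around \<open>f y\<close> pick a path inside the inverse image of \<open>W\<close> under \<open>f\<close>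
    from \<open>y\<close> to a point that \<open>l\<close> sends outside \<open>U\<close>. Take a spine for each \<open>W\<close> and a stem for a path
    from \<open>y0\<close> to \<open>y\<close>, joined at one point whose neighbourhoods contain, for some \<open>W\<close>, all spines
    below \<open>W\<close> and an initial piece of each remaining spine and of the stem. This contractible,
    locally path connected space maps continuously to \<open>X\<close> without having a continuous lift, and it
    is carried by pairs of an open set (the empty set labels the stem) and a parameter in the
    unit interval.

  Uniqueness of the lift is uniqueness on the carrier of \<open>Y\<close>, hence \<^const>\<open>extensional\<close>.
\<close>

definition unique_lifting_property ::
  "'b topology \<Rightarrow> 'b \<Rightarrow> 'a topology \<Rightarrow> 'a \<Rightarrow> ('b \<Rightarrow> 'a) \<Rightarrow> bool" where
  "unique_lifting_property E e0 X x0 p \<longleftrightarrow>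
     pointed_map E e0 X x0 p \<and>
     (\<forall>(Y :: ('a set \<times> real) topology) y0 f.
        connected_space Y \<longrightarrow> locally_path_connected_space Y \<longrightarrow>
        pointed_map Y y0 X x0 f \<longrightarrow>
        induced_map X x0 f ` fundamental_group Y y0
          \<subseteq> induced_map X x0 p ` fundamental_group E e0 \<longrightarrow>
        (\<exists>!l. l \<in> extensional (topspace Y) \<and> pointed_map Y y0 E e0 l \<and>
              (\<forall>y\<in>topspace Y. p (l y) = f y)))"

definition generalized_covering_map ::
  "'b topology \<Rightarrow> 'b \<Rightarrow> 'a topology \<Rightarrow> 'a \<Rightarrow> ('b \<Rightarrow> 'a) \<Rightarrow> bool" where
  "generalized_covering_map E e0 X x0 p \<longleftrightarrow>
     unique_lifting_property E e0 X x0 p \<and>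
     connected_space E \<and> locally_path_connected_space E"

definition fibre :: "'b topology \<Rightarrow> ('b \<Rightarrow> 'a) \<Rightarrow> 'a \<Rightarrow> 'b topology" where
  "fibre E p x = subtopology E {e \<in> topspace E. p e = x}"

definition totally_path_disconnected_space :: "'a topology \<Rightarrow> bool" where
  "totally_path_disconnected_space X \<longleftrightarrow>
     (\<forall>g. pathin X g \<longrightarrow> (\<exists>c. \<forall>t\<in>{0..1}. g t = c))"

end

theory Submission
  imports Defs
begin

text \<open>
  Let \<open>g\<close> be a path in the fibre over \<open>x0\<close>. As \<open>E\<close> is path connected, there is a path \<open>a\<close> from
  the base point \<open>e0\<close> to \<open>g 0\<close>. Follow \<open>a\<close> first by \<open>g\<close> and then, alternatively, by the constant
  path at \<open>g 0\<close>. Both concatenations start at \<open>e0\<close>, and \<open>p\<close> sends both to the path \<open>p \<circ> a\<close>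
  followed by the constant path at \<open>x0\<close>. Uniqueness of lifts on the unit interval makes
  them equal, so \<open>g\<close> is constant.

  Uniqueness is only granted for maps into \<open>X\<close> that satisfy the lifting criterion on fundamental
  groups. A map that already has a lift satisfies it by functoriality
  (\<open>induced_map_image_subset_if_lift\<close>), so two lifts with the same projection always agree
  (\<open>lifts_agree\<close>), and in particular so do two paths (\<open>path_lifts_agree\<close>).
\<close>

lemma comp_in_loops_at:
  assumes "pointed_map Y y0 X x0 f" and "g \<in> loops_at Y y0"
  shows "f \<circ> g \<in> loops_at X x0"
  using assms by (auto simp: pointed_map_def loops_at_def intro: pathin_compose)

lemma loop_homotopy_comp:
  assumes f: "pointed_map Y y0 X x0 f" and gh: "(g, h) \<in> loop_homotopy Y y0"
  shows "(f \<circ> g, f \<circ> h) \<in> loop_homotopy X x0"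
proof -
  have "homotopic_with (\<lambda>l. l 0 = x0 \<and> l 1 = x0) (top_of_set {0..1}) X (f \<circ> g) (f \<circ> h)"
    using gh f unfolding loop_homotopy_def pointed_map_def
    by (auto intro: homotopic_with_compose_continuous_map_left)
  then show ?thesis
    using gh f by (auto simp: loop_homotopy_def intro: comp_in_loops_at)
qed

lemma equiv_loop_homotopy: "equiv (loops_at X x0) (loop_homotopy X x0)"
proof (rule equivI)
  show "loop_homotopy X x0 \<subseteq> loops_at X x0 \<times> loops_at X x0"
    by (auto simp: loop_homotopy_def)
  show "refl_on (loops_at X x0) (loop_homotopy X x0)"
    by (auto simp: refl_on_def loop_homotopy_def loops_at_def pathin_def)
  show "sym (loop_homotopy X x0)"
    by (auto simp: sym_def loop_homotopy_def intro: homotopic_with_symD)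
  show "trans (loop_homotopy X x0)"
    by (auto simp: trans_def loop_homotopy_def intro: homotopic_with_trans)
qed

lemma induced_map_class:
  assumes f: "pointed_map Y y0 X x0 f" and g: "g \<in> loops_at Y y0"
  shows "induced_map X x0 f (loop_homotopy Y y0 `` {g}) = loop_homotopy X x0 `` {f \<circ> g}"
proof -
  have "loop_homotopy X x0 `` {f \<circ> h} = loop_homotopy X x0 `` {f \<circ> g}"
    if "(g, h) \<in> loop_homotopy Y y0" for h
    using equiv_class_eq[OF equiv_loop_homotopy loop_homotopy_comp[OF f that]] by simp
  moreover have "(g, g) \<in> loop_homotopy Y y0"
    using equiv_class_self[OF equiv_loop_homotopy g] by simp
  ultimately show ?thesis
    unfolding induced_map_def by blast
qed

text \<open>The necessity half of the lifting criterion, from \<open>(p \<circ> l)\<^sub>* = p\<^sub>* \<circ> l\<^sub>*\<close>.\<close>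

lemma induced_map_image_subset_if_lift:
  assumes l: "pointed_map Y y0 E e0 l" and p: "pointed_map E e0 X x0 p"
  shows "induced_map X x0 (p \<circ> l) ` fundamental_group Y y0
           \<subseteq> induced_map X x0 p ` fundamental_group E e0"
proof -
  have pl: "pointed_map Y y0 X x0 (p \<circ> l)"
    using l p by (auto simp: pointed_map_def intro: continuous_map_compose)
  have "induced_map X x0 (p \<circ> l) (loop_homotopy Y y0 `` {g})
          \<in> induced_map X x0 p ` fundamental_group E e0" if g: "g \<in> loops_at Y y0" for g
  proof (rule image_eqI)
    have lg: "l \<circ> g \<in> loops_at E e0"
      using l g by (rule comp_in_loops_at)
    show "loop_homotopy E e0 `` {l \<circ> g} \<in> fundamental_group E e0"
      unfolding fundamental_group_def using lg by (rule quotientI)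
    show "induced_map X x0 (p \<circ> l) (loop_homotopy Y y0 `` {g})
            = induced_map X x0 p (loop_homotopy E e0 `` {l \<circ> g})"
      by (simp only: induced_map_class[OF pl g] induced_map_class[OF p lg] comp_assoc)
  qed
  then show ?thesis
    by (auto simp: fundamental_group_def elim!: quotientE)
qed

text \<open>
  The map to be lifted is \<open>p \<circ> l\<close> itself, so the lifting criterion holds because \<open>l\<close> is a lift.
\<close>

lemma lifts_agree:
  fixes X :: "'a topology" and Y :: "('a set \<times> real) topology"
  assumes ulp: "unique_lifting_property E e0 X x0 p"
    and Y: "connected_space Y" "locally_path_connected_space Y"
    and l: "pointed_map Y y0 E e0 l" and m: "pointed_map Y y0 E e0 m"
    and eq: "\<And>y. y \<in> topspace Y \<Longrightarrow> p (l y) = p (m y)"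
    and y: "y \<in> topspace Y"
  shows "l y = m y"
proof -
  have p: "pointed_map E e0 X x0 p"
    using ulp by (simp add: unique_lifting_property_def)
  have pl: "pointed_map Y y0 X x0 (p \<circ> l)"
    using l p by (auto simp: pointed_map_def intro: continuous_map_compose)
  have unique: "\<exists>!k. k \<in> extensional (topspace Y) \<and> pointed_map Y y0 E e0 k \<and>
              (\<forall>y\<in>topspace Y. p (k y) = (p \<circ> l) y)"
    using ulp Y pl induced_map_image_subset_if_lift[OF l p]
    unfolding unique_lifting_property_def by blast
  have restrict: "pointed_map Y y0 E e0 (restrict k (topspace Y))"
    if "pointed_map Y y0 E e0 k" for k
    using that by (auto simp: pointed_map_def intro: continuous_map_eq)
  have "restrict l (topspace Y) = restrict m (topspace Y)"
    using unique restrict[OF l] restrict[OF m] eq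
    by (elim ex1E) (metis (no_types, lifting) comp_apply restrict_apply' restrict_extensional)
  then show ?thesis
    using y by (metis restrict_apply')
qed

lemma path_lifts_agree:
  fixes X :: "'a topology"
  assumes ulp: "unique_lifting_property E e0 X x0 p"
    and g: "pathin E g" "g 0 = e0" and h: "pathin E h" "h 0 = e0"
    and eq: "\<And>t. t \<in> {0..1} \<Longrightarrow> p (g t) = p (h t)"
    and t: "t \<in> {0..1}"
  shows "g t = h t"
proof -
  \<comment> \<open>a copy of the unit interval in the type that carries the test spaces\<close>
  define Y :: "('a set \<times> real) topology"
    where "Y = prod_topology (discrete_topology {{}}) (top_of_set {0..1})"
  have Y: "connected_space Y" "locally_path_connected_space Y"
    unfolding Y_def
    by (auto simp: connected_space_prod_topology connected_space_discrete_topology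
        connected_space_subtopology locally_path_connected_space_prod_topology
        locally_path_connected_space_discrete_topology locally_path_connected_real_interval)
  have topspace_Y: "topspace Y = {{}} \<times> {0..1}"
    by (simp add: Y_def)
  have pointed: "pointed_map Y ({}, 0) E e0 (k \<circ> snd)" if "pathin E k" "k 0 = e0" for k
  proof -
    have "continuous_map Y E (k \<circ> snd)"
      using that(1) continuous_map_snd unfolding Y_def pathin_def
      by (rule continuous_map_compose[rotated])
    then show ?thesis
      using that(2) by (simp add: pointed_map_def topspace_Y)
  qed
  have "(g \<circ> snd) ({} :: 'a set, t) = (h \<circ> snd) ({} :: 'a set, t)"
    by (rule lifts_agree[OF ulp Y pointed[OF g] pointed[OF h]]) (use eq t in \<open>auto simp: topspace_Y\<close>)
  then show ?thesis by simp
qed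

text \<open>
  The operation \<open>+++\<close> needs a topological type class, hence this version for abstract topologies.
\<close>

lemma pathin_concatenation:
  assumes g: "pathin X g" and h: "pathin X h" and "g 1 = h 0"
  shows "pathin X (\<lambda>t. if t \<le> 1/2 then g (2 * t) else h (2 * t - 1))"
proof -
  let ?I = "top_of_set {0..1::real}"
  have "continuous_map ?I X (\<lambda>t. if t \<le> 1/2 then (g \<circ> (\<lambda>t. 2 * t)) t else (h \<circ> (\<lambda>t. 2 * t - 1)) t)"
  proof (intro continuous_map_cases_le continuous_map_compose)
    show "continuous_map (subtopology ?I {t \<in> topspace ?I. t \<le> 1/2}) ?I (\<lambda>t. 2 * t)"
      by (auto simp: continuous_map_in_subtopology subtopology_subtopology intro!: continuous_intros)
    show "continuous_map (subtopology ?I {t \<in> topspace ?I. 1/2 \<le> t}) ?I (\<lambda>t. 2 * t - 1)"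
      by (auto simp: continuous_map_in_subtopology subtopology_subtopology intro!: continuous_intros)
    show "(g \<circ> (\<lambda>t. 2 * t)) t = (h \<circ> (\<lambda>t. 2 * t - 1)) t" if "t = 1/2" for t
      unfolding that using assms(3) by simp
  qed (use assms in \<open>auto simp: pathin_def\<close>)
  then show ?thesis
    unfolding pathin_def o_def .
qed

theorem proposition3p2:
  fixes X :: "'a topology" and x0 :: 'a
    and E :: "'b topology" and e0 :: 'b
    and p :: "'b \<Rightarrow> 'a"
  assumes "x0 \<in> topspace X"
    and "generalized_covering_map E e0 X x0 p"
  shows "totally_path_disconnected_space (fibre E p x0)"
proof -
  have ulp: "unique_lifting_property E e0 X x0 p"
    and "path_connected_space E"
    using assms(2) by (auto simp: generalized_covering_map_def path_connected_eq_connected_space)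
  moreover have "e0 \<in> topspace E"
    using ulp by (simp add: unique_lifting_property_def pointed_map_def)
  ultimately have reach: "\<exists>a. pathin E a \<and> a 0 = e0 \<and> a 1 = e" if "e \<in> topspace E" for e
    using that by (auto simp: path_connected_space_def)
  have "g s = g 0" if "pathin (fibre E p x0) g" and s: "s \<in> {0..1}" for g s
  proof -
    have g: "pathin E g" and fibre: "\<And>t. t \<in> {0..1} \<Longrightarrow> p (g t) = x0"
      using that(1) by (auto simp: fibre_def pathin_subtopology)
    have g0: "g 0 \<in> topspace E"
      using g by (rule path_start_in_topspace)
    obtain a where a: "pathin E a" "a 0 = e0" "a 1 = g 0"
      using reach[OF g0] by blast
    \<comment> \<open>the two concatenations; the second half of \<open>u\<close> reaches \<open>g s\<close> at time \<open>(1 + s) / 2\<close>\<close>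
    define u where "u = (\<lambda>t. if t \<le> 1/2 then a (2 * t) else g (2 * t - 1))"
    define v where "v = (\<lambda>t::real. if t \<le> 1/2 then a (2 * t) else g 0)"
    have "pathin E u"
      unfolding u_def using a g by (intro pathin_concatenation) auto
    moreover have "pathin E v"
      unfolding v_def using pathin_concatenation[OF a(1), of "\<lambda>_. g 0"] a(3) g0 by simp
    moreover have "p (u t) = p (v t)" if "t \<in> {0..1}" for t
      using that fibre by (auto simp: u_def v_def)
    moreover have "(1 + s) / 2 \<in> {0..1}"
      using s by auto
    ultimately have "u ((1 + s) / 2) = v ((1 + s) / 2)"
      using a(2) path_lifts_agree[OF ulp, of u v "(1 + s) / 2"] by (simp add: u_def v_def)
    then show ?thesis
      using s by (cases "s = 0") (auto simp: u_def v_def add_divide_distrib)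
  qed
  then show ?thesis
    unfolding totally_path_disconnected_space_def by blast
qed

end
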